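(* Let $(\mathfrak{H},[\cdot,\cdot])$ be a Krein space with fundamental symmetry $J$ and let $\mathcal{F}=\{f_n\}_{n\in\mathbb{N}}$ be a $J$-orthogonal Schauder basis of the Hilbert space $(\mathfrak{H},(\cdot,\cdot))$. Then $\mathcal{F}$ is a $J$-frame if and only if $\mathcal{F}$ is $J$-bounded, i.e. there are constants $A,B$ with $0<A\le|[f_n,f_n]|\le B<\infty$ for all $n\in\mathbb{N}$.
   Context: A Krein space $(\mathfrak{H},[\cdot,\cdot])$ is a complex (infinite-dimensional) linear space with an indefinite inner product admitting a fundamental decomposition $\mathfrak{H}=\mathfrak{H}_+[\dot{+}]\mathfrak{H}_-$, a $[\cdot,\cdot]$-orthogonal direct sum of Hilbert spaces $(\mathfrak{H}_+,[\cdot,\cdot])$ and $(\mathfrak{H}_-,-[\cdot,\cdot])$. A fundamental decomposition is fixed; its fundamental symmetry is $J(f_++f_-)=f_+-f_-$ ($f_\pm\in\mathfrak{H}_\pm$), and $(\cdot,\cdot)=[J\cdot,\cdot]$, $\|\cdot\|=\sqrt{(\cdot,\cdot)}$ is the associated Hilbert space inner product and norm. Subspaces are closed and topological notions refer to $\|\cdot\|$. A subspace $\mathcal{L}$ is positive (negative) if $[f,f]>0$ ($[f,f]<0$) for all nonzero $f\in\mathcal{L}$, and maximal positive (negative) if it is not a proper subspace of another positive (negative) subspace. A sequence is $J$-orthogonal if $[f_n,f_m]=0$ for $n\ne m$. For $\mathcal{F}=\{f_n\}$ put $\mathbb{N}_+=\{n:[f_n,f_n]\ge0\}$, $\mathbb{N}_-=\{n:[f_n,f_n]<0\}$,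 $\mathcal{F}_\pm=\{f_n\}_{n\in\mathbb{N}_\pm}$, $\mathcal{M}_\pm=\overline{\mathrm{span}\,\mathcal{F}_\pm}$. $\mathcal{F}$ is a $J$-frame if $\mathcal{M}_+$ is maximal positive, $\mathcal{M}_-$ is maximal negative, and there are constants $0<A\le B$ with $A|[f,f]|\le\sum_{n\in\mathbb{N}_+}|[f,f_n]|^2\le B|[f,f]|$ for all $f\in\mathrm{span}\,\mathcal{F}_+$, and $A|[f,f]|\le\sum_{n\in\mathbb{N}_-}|[f,f_n]|^2\le B|[f,f]|$ for all $f\in\mathrm{span}\,\mathcal{F}_-$. *)

theory Defs
  imports "HOL-Analysis.Analysis"
begin

text \<open>
  The ambient space is a type with an explicit complex scalar multiplication. Forms are linear in
  the first and conjugate-linear in the second argument. Hermitian symmetry makes \<open>b x x\<close> real,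
  so sign conditions on it are conditions on its real part.
\<close>

definition hermitian_form ::
  "(complex \<Rightarrow> 'a \<Rightarrow> 'a) \<Rightarrow> ('a::ab_group_add \<Rightarrow> 'a \<Rightarrow> complex) \<Rightarrow> bool" where
  "hermitian_form cscale b \<longleftrightarrow>
     (\<forall>x y z. b (x + y) z = b x z + b y z) \<and>
     (\<forall>c x y. b (cscale c x) y = c * b x y) \<and>
     (\<forall>x y. b y x = cnj (b x y))"

text \<open>
  The norm of \<open>x\<close> in \<open>S\<close> is the square root of \<open>b x x\<close>. The modulus does not change this value on
  \<open>S\<close>; it only keeps the distance nonnegative off \<open>S\<close>, as the locale \<open>Metric_space\<close> demands.
\<close>

definition hilbert_subspace ::
  "(complex \<Rightarrow> 'a \<Rightarrow> 'a) \<Rightarrow> ('a::ab_group_add \<Rightarrow> 'a \<Rightarrow> complex) \<Rightarrow> 'a set \<Rightarrow> bool" where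
  "hilbert_subspace cscale b S \<longleftrightarrow>
     module.subspace cscale S \<and>
     (\<forall>x\<in>S. x \<noteq> 0 \<longrightarrow> 0 < Re (b x x)) \<and>
     Metric_space.mcomplete S (\<lambda>x y. sqrt (cmod (b (x - y) (x - y))))"

text \<open>
  A Krein space together with a fixed fundamental decomposition and its fundamental symmetry.
  Either of \<open>Hp\<close>, \<open>Hm\<close> may be trivial.
\<close>

locale krein_space = vector_space cscale
  for cscale :: "complex \<Rightarrow> 'a::ab_group_add \<Rightarrow> 'a" (infixr "*\<^sub>C" 75) +
  fixes ip :: "'a \<Rightarrow> 'a \<Rightarrow> complex"
    and Hp Hm :: "'a set"
    and J :: "'a \<Rightarrow> 'a"
  assumes ip_hermitian: "hermitian_form cscale ip"
    and infinite_dimensional: "\<not> (\<exists>B. finite B \<and> span B = UNIV)"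
    and hilbert_plus: "hilbert_subspace cscale ip Hp"
    and hilbert_minus: "hilbert_subspace cscale (\<lambda>x y. - ip x y) Hm"
    and ip_orthogonal: "\<And>x y. x \<in> Hp \<Longrightarrow> y \<in> Hm \<Longrightarrow> ip x y = 0"
    and decomposition_ex: "\<And>x. \<exists>p\<in>Hp. \<exists>m\<in>Hm. x = p + m"
    and decomposition_direct: "Hp \<inter> Hm = {0}"
    and fundamental_symmetry: "\<And>p m. p \<in> Hp \<Longrightarrow> m \<in> Hm \<Longrightarrow> J (p + m) = p - m"
begin

definition J_ip :: "'a \<Rightarrow> 'a \<Rightarrow> complex" where
  "J_ip x y = ip (J x) y"

definition J_norm :: "'a \<Rightarrow> real" where
  "J_norm x = sqrt (Re (J_ip x x))"

definition J_topology :: "'a topology" where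
  "J_topology = Metric_space.mtopology UNIV (\<lambda>x y. J_norm (x - y))"

definition closed_subspace :: "'a set \<Rightarrow> bool" where
  "closed_subspace L \<longleftrightarrow> subspace L \<and> closedin J_topology L"

definition positive_subspace :: "'a set \<Rightarrow> bool" where
  "positive_subspace L \<longleftrightarrow> closed_subspace L \<and> (\<forall>x\<in>L. x \<noteq> 0 \<longrightarrow> 0 < Re (ip x x))"

definition negative_subspace :: "'a set \<Rightarrow> bool" where
  "negative_subspace L \<longleftrightarrow> closed_subspace L \<and> (\<forall>x\<in>L. x \<noteq> 0 \<longrightarrow> Re (ip x x) < 0)"

definition maximal_positive :: "'a set \<Rightarrow> bool" where
  "maximal_positive L \<longleftrightarrow> positive_subspace L \<and> \<not> (\<exists>L'. positive_subspace L' \<and> L \<subset> L')"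

definition maximal_negative :: "'a set \<Rightarrow> bool" where
  "maximal_negative L \<longleftrightarrow> negative_subspace L \<and> \<not> (\<exists>L'. negative_subspace L' \<and> L \<subset> L')"

definition J_orthogonal :: "(nat \<Rightarrow> 'a) \<Rightarrow> bool" where
  "J_orthogonal f \<longleftrightarrow> (\<forall>n m. n \<noteq> m \<longrightarrow> ip (f n) (f m) = 0)"

definition schauder_basis :: "(nat \<Rightarrow> 'a) \<Rightarrow> bool" where
  "schauder_basis f \<longleftrightarrow>
     (\<forall>x. \<exists>!c. limitin J_topology (\<lambda>N. \<Sum>n<N. c n *\<^sub>C f n) x sequentially)"

definition J_bounded :: "(nat \<Rightarrow> 'a) \<Rightarrow> bool" where
  "J_bounded f \<longleftrightarrow>
     (\<exists>A B :: real. 0 < A \<and> (\<forall>n. A \<le> cmod (ip (f n) (f n)) \<and> cmod (ip (f n) (f n)) \<le> B))"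

definition N_plus :: "(nat \<Rightarrow> 'a) \<Rightarrow> nat set" where
  "N_plus f = {n. 0 \<le> Re (ip (f n) (f n))}"

definition N_minus :: "(nat \<Rightarrow> 'a) \<Rightarrow> nat set" where
  "N_minus f = {n. Re (ip (f n) (f n)) < 0}"

definition M_plus :: "(nat \<Rightarrow> 'a) \<Rightarrow> 'a set" where
  "M_plus f = J_topology closure_of span (f ` N_plus f)"

definition M_minus :: "(nat \<Rightarrow> 'a) \<Rightarrow> 'a set" where
  "M_minus f = J_topology closure_of span (f ` N_minus f)"

text \<open>
  Summability is required explicitly, since \<open>infsum\<close> is \<open>0\<close> for a divergent sum.
\<close>

definition frame_bounds :: "(nat \<Rightarrow> 'a) \<Rightarrow> nat set \<Rightarrow> real \<Rightarrow> real \<Rightarrow> bool" where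
  "frame_bounds f N A B \<longleftrightarrow>
     (\<forall>x \<in> span (f ` N).
        (\<lambda>n. (cmod (ip x (f n)))\<^sup>2) summable_on N \<and>
        A * cmod (ip x x) \<le> (\<Sum>\<^sub>\<infinity>n\<in>N. (cmod (ip x (f n)))\<^sup>2) \<and>
        (\<Sum>\<^sub>\<infinity>n\<in>N. (cmod (ip x (f n)))\<^sup>2) \<le> B * cmod (ip x x))"

definition J_frame :: "(nat \<Rightarrow> 'a) \<Rightarrow> bool" where
  "J_frame f \<longleftrightarrow>
     maximal_positive (M_plus f) \<and> maximal_negative (M_minus f) \<and>
     (\<exists>A B. 0 < A \<and> A \<le> B \<and>
        frame_bounds f (N_plus f) A B \<and> frame_bounds f (N_minus f) A B)"

end

end

theory Submission
  imports Defs
begin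

text \<open>
  Since \<open>f\<close> is total and \<open>J\<close>-orthogonal, no \<open>f n\<close> is neutral, and the coefficients of \<open>x\<close> are
  \<open>ip x (f n) / ip (f n) (f n)\<close>. On finite sums the frame inequalities therefore compare
  \<open>\<Sum>|c n|\<^sup>2 |ip (f n) (f n)|\<^sup>2\<close> with \<open>\<Sum>|c n|\<^sup>2 |ip (f n) (f n)|\<close>, so they hold with
  bounds \<open>A\<close> and \<open>B\<close> exactly if all \<open>|ip (f n) (f n)|\<close> lie between \<open>A\<close> and \<open>B\<close>.

  The maximality of \<open>M_plus f\<close> and \<open>M_minus f\<close> holds for every \<open>J\<close>-orthogonal Schauder basis,
  although the two halves of an expansion need not converge separately. If \<open>x\<close> lies in a positive
  subspace containing \<open>M_plus f\<close>, Bessel's inequality there bounds the contribution of the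
  positive \<open>f n\<close> to \<open>ip x x\<close> by \<open>ip x x\<close>. As the contributions of all \<open>f n\<close> sum up to \<open>ip x x\<close>,
  those of the negative ones vanish, so \<open>x\<close> lies in \<open>M_plus f\<close>.
\<close>

section \<open>Cauchy-Schwarz inequality for positive semidefinite Hermitian forms\<close>

lemma hermitian_form_Cauchy_Schwarz:
  assumes b: "hermitian_form cscale b" and nonneg: "\<And>x. 0 \<le> Re (b x x)"
  shows "(cmod (b x y))\<^sup>2 \<le> Re (b x x) * Re (b y y)"
proof -
  define a P Q where "a = b x y" and "P = Re (b x x)" and "Q = Re (b y y)"
  have add: "b (u + v) w = b u w + b v w" and scale: "b (cscale c u) v = c * b u v"
    and sym: "b v u = cnj (b u v)" for u v w c
    using b unfolding hermitian_form_def by blast+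
  have add': "b w (u + v) = b w u + b w v" for u v w
    by (metis add sym complex_cnj_add)
  have scale': "b v (cscale c u) = cnj c * b v u" for u v c
    by (metis scale sym complex_cnj_mult)
  have "Re (b y y) = b y y"
    using arg_cong[OF sym[of y y], of Im] by (simp add: complex_eq_iff)
  then have Qc: "b y y = of_real Q" by (simp add: Q_def)
  have main: "0 \<le> P - 2 * t * (cmod a)\<^sup>2 + t\<^sup>2 * (cmod a)\<^sup>2 * Q" for t :: real
  proof -
    \<comment> \<open>This phase of \<open>c\<close> makes both cross terms real and equal, so
      nonnegativity of the form at \<open>x + cscale c y\<close> becomes a real quadratic inequality
      in \<open>t\<close>.\<close>
    define c where "c = - of_real t * a"
    have aa: "of_real ((cmod a)\<^sup>2) = a * cnj a"
      by (rule complex_norm_square)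
    have "b (x + cscale c y) (x + cscale c y) = b x x + cnj c * a + c * cnj a + c * cnj c * of_real Q"
      using sym[of y x] by (simp add: add add' scale scale' a_def Qc algebra_simps)
    moreover have "cnj c * a = of_real (- t * (cmod a)\<^sup>2)"
      "c * cnj a = of_real (- t * (cmod a)\<^sup>2)" "c * cnj c = of_real (t\<^sup>2 * (cmod a)\<^sup>2)"
      unfolding c_def of_real_mult aa by (simp_all add: power2_eq_square mult_ac)
    ultimately have "b (x + cscale c y) (x + cscale c y)
      = b x x + of_real (- t * (cmod a)\<^sup>2) + of_real (- t * (cmod a)\<^sup>2)
        + of_real (t\<^sup>2 * (cmod a)\<^sup>2) * of_real Q" by simp
    then have "Re (b (x + cscale c y) (x + cscale c y))
      = P - t * (cmod a)\<^sup>2 - t * (cmod a)\<^sup>2 + t\<^sup>2 * (cmod a)\<^sup>2 * Q"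
      by (simp only: P_def plus_complex.sel Re_complex_of_real flip: of_real_mult)
    then show ?thesis using nonneg[of "x + cscale c y"] by simp
  qed
  have "0 \<le> P" "0 \<le> Q" using nonneg by (auto simp: P_def Q_def)
  have "(cmod a)\<^sup>2 \<le> P * Q"
  proof (cases "Q = 0")
    case True
    have "a = 0"
    proof (rule ccontr)
      assume "a \<noteq> 0"
      \<comment> \<open>With \<open>Q = 0\<close> the bound is affine in \<open>t\<close>; this
        \<open>t\<close> pushes it down to \<open>- P - 2\<close>, which is negative.\<close>
      then have "0 \<le> P - 2 * (P + 1)"
        using main[of "(P + 1) / (cmod a)\<^sup>2"] True by simp
      then show False using \<open>0 \<le> P\<close> by simp
    qed
    then show ?thesis using True by simp
  next
    case False
    \<comment> \<open>For \<open>Q \<noteq> 0\<close> the value \<open>t = 1 / Q\<close> minimises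
      the quadratic when \<open>a \<noteq> 0\<close>.\<close>
    then have "0 \<le> P - (cmod a)\<^sup>2 / Q"
      using main[of "1 / Q"] by (simp add: power2_eq_square)
    then show ?thesis using False \<open>0 \<le> Q\<close> by (simp add: field_simps)
  qed
  then show ?thesis by (simp add: a_def P_def Q_def)
qed

context krein_space
begin

section \<open>Sesquilinear algebra of the indefinite form\<close>

lemma ip_add_left: "ip (x + y) z = ip x z + ip y z"
  and ip_scale_left: "ip (c *\<^sub>C x) y = c * ip x y"
  and ip_commute: "ip y x = cnj (ip x y)"
  using ip_hermitian unfolding hermitian_form_def by blast+

lemma ip_add_right: "ip z (x + y) = ip z x + ip z y"
  by (metis ip_add_left ip_commute complex_cnj_add)

lemma ip_zero_left [simp]: "ip 0 x = 0"
  using ip_add_left[of 0 0 x] by simp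

lemma ip_zero_right [simp]: "ip x 0 = 0"
  using ip_add_right[of x 0 0] by simp

lemma ip_minus_left: "ip (- x) y = - ip x y"
  using ip_add_left[of x "- x" y] by (simp add: add_eq_0_iff)

lemma ip_minus_right: "ip y (- x) = - ip y x"
  using ip_add_right[of y x "- x"] by (simp add: add_eq_0_iff)

lemma ip_diff_left: "ip (x - y) z = ip x z - ip y z"
  using ip_add_left[of x "- y" z] by (simp add: ip_minus_left)

lemma ip_diff_right: "ip z (x - y) = ip z x - ip z y"
  using ip_add_right[of z x "- y"] by (simp add: ip_minus_right)

lemma ip_sum_left: "ip (\<Sum>i\<in>F. g i) y = (\<Sum>i\<in>F. ip (g i) y)"
  by (induction F rule: infinite_finite_induct) (auto simp: ip_add_left)

lemma ip_self_of_real: "ip x x = of_real (Re (ip x x))"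
  using arg_cong[OF ip_commute[of x x], of Im] by (simp add: complex_eq_iff)

lemma cmod_ip_self: "cmod (ip x x) = \<bar>Re (ip x x)\<bar>"
  by (subst ip_self_of_real) simp

section \<open>The fundamental decomposition and its symmetry\<close>

lemma subspace_Hp: "subspace Hp" and Hp_pos: "x \<in> Hp \<Longrightarrow> x \<noteq> 0 \<Longrightarrow> 0 < Re (ip x x)"
  using hilbert_plus unfolding hilbert_subspace_def by auto

lemma subspace_Hm: "subspace Hm" and Hm_neg: "x \<in> Hm \<Longrightarrow> x \<noteq> 0 \<Longrightarrow> Re (ip x x) < 0"
  using hilbert_minus unfolding hilbert_subspace_def by auto

lemma decompose:
  obtains p m where "p \<in> Hp" "m \<in> Hm" "x = p + m" "J x = p - m"
  using decomposition_ex[of x] fundamental_symmetry by metis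

lemma J_add: "J (x + y) = J x + J y"
proof -
  obtain p m q n where *: "p \<in> Hp" "m \<in> Hm" "x = p + m" "J x = p - m"
    "q \<in> Hp" "n \<in> Hm" "y = q + n" "J y = q - n"
    by (metis decompose)
  have "J ((p + q) + (m + n)) = (p + q) - (m + n)"
    using * subspace_Hp subspace_Hm by (intro fundamental_symmetry) (auto intro: subspace_add)
  moreover have "x + y = (p + q) + (m + n)" using * by simp
  ultimately show ?thesis using *(4,8) by simp
qed

lemma J_scale: "J (c *\<^sub>C x) = c *\<^sub>C J x"
proof -
  obtain p m where *: "p \<in> Hp" "m \<in> Hm" "x = p + m" "J x = p - m"
    by (metis decompose)
  have "J (c *\<^sub>C p + c *\<^sub>C m) = c *\<^sub>C p - c *\<^sub>C m"
    using * subspace_Hp subspace_Hm by (intro fundamental_symmetry) (auto intro: subspace_scale)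
  then show ?thesis using * by (simp add: scale_right_distrib scale_right_diff_distrib)
qed

lemma J_involution: "J (J x) = x"
proof -
  obtain p m where *: "p \<in> Hp" "m \<in> Hm" "x = p + m" "J x = p - m"
    by (metis decompose)
  then show ?thesis
    using fundamental_symmetry[of p "- m"] subspace_neg[OF subspace_Hm] by auto
qed

lemma ip_orthogonal': "x \<in> Hm \<Longrightarrow> y \<in> Hp \<Longrightarrow> ip x y = 0"
  using ip_orthogonal[of y x] ip_commute[of x y] by simp

lemma ip_J_left: "ip (J x) y = ip x (J y)"
proof -
  obtain p m q n where *: "p \<in> Hp" "m \<in> Hm" "x = p + m" "J x = p - m"
    "q \<in> Hp" "n \<in> Hm" "y = q + n" "J y = q - n"
    by (metis decompose)
  then show ?thesis
    by (simp add: ip_add_left ip_add_right ip_diff_left ip_diff_right ip_orthogonal ip_orthogonal')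
qed

section \<open>The definite inner product and its norm\<close>

lemma hermitian_form_J_ip: "hermitian_form cscale J_ip"
  unfolding hermitian_form_def J_ip_def
proof (intro conjI allI)
  fix x y
  show "ip (J y) x = cnj (ip (J x) y)"
    by (simp add: ip_J_left flip: ip_commute)
qed (simp_all add: J_add J_scale ip_add_left ip_scale_left)

lemma J_ip_pos: "x \<noteq> 0 \<Longrightarrow> 0 < Re (J_ip x x)"
proof -
  assume "x \<noteq> 0"
  obtain p m where *: "p \<in> Hp" "m \<in> Hm" "x = p + m" "J x = p - m"
    by (metis decompose)
  have "J_ip x x = ip p p - ip m m"
    using * by (simp add: J_ip_def ip_add_right ip_diff_left ip_orthogonal ip_orthogonal')
  moreover have "p \<noteq> 0 \<or> m \<noteq> 0" using * \<open>x \<noteq> 0\<close> by auto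
  moreover have "p \<noteq> 0 \<longrightarrow> 0 < Re (ip p p)" "m \<noteq> 0 \<longrightarrow> Re (ip m m) < 0"
    using * Hp_pos Hm_neg by auto
  ultimately show ?thesis by (cases "p = 0"; cases "m = 0") auto
qed

lemma J_ip_nonneg: "0 \<le> Re (J_ip x x)"
  using J_ip_pos[of x] by (cases "x = 0") (auto simp: J_ip_def)

lemma J_norm_nonneg [simp]: "0 \<le> J_norm x"
  by (simp add: J_norm_def J_ip_nonneg)

lemma J_norm_power2: "(J_norm x)\<^sup>2 = Re (J_ip x x)"
  by (simp add: J_norm_def J_ip_nonneg)

lemma J_norm_eq_0_iff [simp]: "J_norm x = 0 \<longleftrightarrow> x = 0"
  using J_ip_pos[of x] J_norm_power2[of x] by (cases "x = 0") (auto simp: J_norm_def J_ip_def)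

lemma J_norm_minus: "J_norm (- x) = J_norm x"
  using J_scale[of "- 1" x] by (simp add: J_norm_def J_ip_def ip_minus_left ip_minus_right)

lemma cmod_J_ip_le: "cmod (J_ip x y) \<le> J_norm x * J_norm y"
proof (rule power2_le_imp_le)
  show "(cmod (J_ip x y))\<^sup>2 \<le> (J_norm x * J_norm y)\<^sup>2"
    using hermitian_form_Cauchy_Schwarz[OF hermitian_form_J_ip J_ip_nonneg]
    by (simp add: power_mult_distrib J_norm_power2)
qed simp

lemma J_norm_J: "J_norm (J x) = J_norm x"
  by (simp add: J_norm_def J_ip_def ip_J_left J_involution)

text \<open>Since \<open>J\<close> is an isometric involution, \<open>ip x y = J_ip (J x) y\<close>
  inherits the Cauchy-Schwarz bound of the definite product. This is the source of continuity for
  the indefinite form.\<close>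

lemma cmod_ip_le: "cmod (ip x y) \<le> J_norm x * J_norm y"
  using cmod_J_ip_le[of "J x" y] by (simp add: J_ip_def J_involution J_norm_J)

lemma J_norm_triangle: "J_norm (x + y) \<le> J_norm x + J_norm y"
proof (rule power2_le_imp_le)
  have "J_ip (x + y) (x + y) = J_ip x x + J_ip y y + (J_ip x y + cnj (J_ip x y))"
    by (simp add: J_ip_def J_add ip_add_left ip_add_right ip_J_left flip: ip_commute)
  then have "(J_norm (x + y))\<^sup>2 = (J_norm x)\<^sup>2 + (J_norm y)\<^sup>2 + 2 * Re (J_ip x y)"
    by (simp add: J_norm_power2)
  also have "\<dots> \<le> (J_norm x)\<^sup>2 + (J_norm y)\<^sup>2 + 2 * (J_norm x * J_norm y)"
    using complex_Re_le_cmod[of "J_ip x y"] cmod_J_ip_le[of x y] by linarith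
  finally show "(J_norm (x + y))\<^sup>2 \<le> (J_norm x + J_norm y)\<^sup>2"
    by (simp add: power2_sum)
qed simp

section \<open>The norm topology and continuity of the indefinite form\<close>

sublocale J_metric: Metric_space UNIV "\<lambda>x y. J_norm (x - y)"
proof
  fix x y z
  show "J_norm (x - y) = J_norm (y - x)"
    using J_norm_minus[of "x - y"] by simp
  show "J_norm (x - z) \<le> J_norm (x - y) + J_norm (y - z)"
    using J_norm_triangle[of "x - y" "y - z"] by simp
qed simp_all

lemma topspace_J_topology [simp]: "topspace J_topology = UNIV"
  by (simp add: J_topology_def)

lemma limitin_J_topology:
  "limitin J_topology s x F \<longleftrightarrow> ((\<lambda>n. J_norm (s n - x)) \<longlongrightarrow> 0) F"
  unfolding J_topology_def J_metric.limitin_metric tendsto_iff by simp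

lemma tendsto_ip_left:
  assumes "limitin J_topology s x F"
  shows "((\<lambda>n. ip (s n) y) \<longlongrightarrow> ip x y) F"
proof (rule LIM_zero_cancel, rule Lim_null_comparison)
  show "((\<lambda>n. J_norm (s n - x) * J_norm y) \<longlongrightarrow> 0) F"
    using assms by (auto simp: limitin_J_topology intro: tendsto_mult_left_zero)
  show "\<forall>\<^sub>F n in F. norm (ip (s n) y - ip x y) \<le> J_norm (s n - x) * J_norm y"
    using cmod_ip_le by (auto simp flip: ip_diff_left)
qed

text \<open>Both arguments vary here. Expanding \<open>ip (s n - x) (s n - x)\<close>, which tends
  to 0, leaves only terms with one argument fixed, whose limits are known.\<close>

lemma tendsto_ip_self:
  assumes "limitin J_topology s x F"
  shows "((\<lambda>n. ip (s n) (s n)) \<longlongrightarrow> ip x x) F"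
proof -
  let ?d = "\<lambda>n. J_norm (s n - x)"
  have d: "(?d \<longlongrightarrow> 0) F" using assms by (simp add: limitin_J_topology)
  have "((\<lambda>n. ip (s n - x) (s n - x)) \<longlongrightarrow> 0) F"
  proof (rule Lim_null_comparison)
    show "\<forall>\<^sub>F n in F. norm (ip (s n - x) (s n - x)) \<le> ?d n * ?d n"
      using cmod_ip_le by auto
    show "((\<lambda>n. ?d n * ?d n) \<longlongrightarrow> 0) F"
      using tendsto_mult[OF d d] by simp
  qed
  moreover have "((\<lambda>n. cnj (ip (s n) x)) \<longlongrightarrow> cnj (ip x x)) F"
    by (intro tendsto_intros tendsto_ip_left assms)
  moreover have "((\<lambda>n. ip (s n) x) \<longlongrightarrow> ip x x) F"
    by (intro tendsto_ip_left assms)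
  ultimately have "((\<lambda>n. ip (s n - x) (s n - x) + cnj (ip (s n) x) + ip (s n) x - ip x x)
      \<longlongrightarrow> 0 + cnj (ip x x) + ip x x - ip x x) F"
    by (intro tendsto_intros)
  then show ?thesis
    by (simp add: ip_diff_left ip_diff_right flip: ip_commute)
qed

lemma closedin_orthogonal: "closedin J_topology {x. ip x y = 0}"
  unfolding J_topology_def J_metric.metric_closedin_iff_sequentially_closed
proof (intro conjI allI impI)
  fix s x
  assume *: "range s \<subseteq> {x. ip x y = 0} \<and> limitin J_metric.mtopology s x sequentially"
  then have "(\<lambda>n. ip (s n) y) \<longlonglongrightarrow> ip x y"
    by (intro tendsto_ip_left) (simp add: J_topology_def)
  moreover have "ip (s n) y = 0" for n using * by auto
  ultimately show "x \<in> {x. ip x y = 0}"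
    by (simp add: LIMSEQ_const_iff)
qed simp

text \<open>The sign \<open>s\<close> is 1 or -1 in use, so that one argument serves the positive
  and the negative case.\<close>

definition definite_subspace :: "real \<Rightarrow> 'a set \<Rightarrow> bool" where
  "definite_subspace s L \<longleftrightarrow> closed_subspace L \<and> (\<forall>x\<in>L. x \<noteq> 0 \<longrightarrow> 0 < s * Re (ip x x))"

lemma maximal_positive_iff:
  "maximal_positive L \<longleftrightarrow>
     definite_subspace 1 L \<and> \<not> (\<exists>L'. definite_subspace 1 L' \<and> L \<subset> L')"
  by (simp add: maximal_positive_def positive_subspace_def definite_subspace_def)

lemma maximal_negative_iff:
  "maximal_negative L \<longleftrightarrow>
     definite_subspace (- 1) L \<and> \<not> (\<exists>L'. definite_subspace (- 1) L' \<and> L \<subset> L')"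
  by (simp add: maximal_negative_def negative_subspace_def definite_subspace_def)

end

section \<open>Expansions in a J-orthogonal Schauder basis\<close>

locale J_orthogonal_basis = krein_space +
  fixes f :: "nat \<Rightarrow> 'a"
  assumes basis: "schauder_basis f" and orthogonal: "J_orthogonal f"
begin

lemma ip_basis: "n \<noteq> m \<Longrightarrow> ip (f n) (f m) = 0"
  using orthogonal by (auto simp: J_orthogonal_def)

lemma ip_combination_left: "ip (\<Sum>i\<in>F. c i *\<^sub>C f i) x = (\<Sum>i\<in>F. c i * cnj (ip x (f i)))"
  by (simp add: ip_sum_left ip_scale_left flip: ip_commute)

lemma ip_combination_basis:
  assumes "finite F"
  shows "ip (\<Sum>i\<in>F. c i *\<^sub>C f i) (f n) = (if n \<in> F then c n * ip (f n) (f n) else 0)"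
proof -
  have "ip (\<Sum>i\<in>F. c i *\<^sub>C f i) (f n) = (\<Sum>i\<in>F. if i = n then c n * ip (f n) (f n) else 0)"
    unfolding ip_sum_left by (intro sum.cong refl) (auto simp: ip_scale_left ip_basis)
  then show ?thesis using assms by simp
qed

lemma ip_combination_self:
  assumes "finite F"
  shows "ip (\<Sum>i\<in>F. c i *\<^sub>C f i) (\<Sum>i\<in>F. c i *\<^sub>C f i)
    = of_real (\<Sum>i\<in>F. (cmod (c i))\<^sup>2 * Re (ip (f i) (f i)))"
proof -
  have "ip (\<Sum>i\<in>F. c i *\<^sub>C f i) (\<Sum>i\<in>F. c i *\<^sub>C f i)
    = (\<Sum>i\<in>F. c i * cnj (ip (\<Sum>i\<in>F. c i *\<^sub>C f i) (f i)))"
    by (rule ip_combination_left)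
  also have "\<dots> = (\<Sum>i\<in>F. c i * cnj (c i) * ip (f i) (f i))"
    using assms by (intro sum.cong refl) (simp add: ip_combination_basis flip: ip_commute)
  also have "\<dots> = (\<Sum>i\<in>F. of_real ((cmod (c i))\<^sup>2 * Re (ip (f i) (f i))))"
  proof (intro sum.cong refl)
    fix i
    show "c i * cnj (c i) * ip (f i) (f i) = of_real ((cmod (c i))\<^sup>2 * Re (ip (f i) (f i)))"
      unfolding of_real_mult complex_norm_square by (simp flip: ip_self_of_real)
  qed
  finally show ?thesis by simp
qed

lemma expansion_ex:
  obtains c where "limitin J_topology (\<lambda>N. \<Sum>n<N. c n *\<^sub>C f n) x sequentially"
  using basis unfolding schauder_basis_def by blast

text \<open>Paired with \<open>f n\<close>, the partial sums are constant once \<open>N > n\<close>,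
  and the pairing is continuous.\<close>

lemma expansion_coefficient:
  assumes "limitin J_topology (\<lambda>N. \<Sum>n<N. c n *\<^sub>C f n) x sequentially"
  shows "ip x (f n) = c n * ip (f n) (f n)"
proof (rule LIMSEQ_unique[OF tendsto_ip_left[OF assms]])
  have "\<forall>\<^sub>F N in sequentially. ip (\<Sum>i<N. c i *\<^sub>C f i) (f n) = c n * ip (f n) (f n)"
    using eventually_gt_at_top[of n] by eventually_elim (simp add: ip_combination_basis)
  then show "(\<lambda>N. ip (\<Sum>i<N. c i *\<^sub>C f i) (f n)) \<longlonglongrightarrow> c n * ip (f n) (f n)"
    by (rule tendsto_eventually)
qed

lemma expansion_form:
  assumes "limitin J_topology (\<lambda>N. \<Sum>n<N. c n *\<^sub>C f n) x sequentially"
  shows "(\<lambda>n. (cmod (c n))\<^sup>2 * Re (ip (f n) (f n))) sums Re (ip x x)"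
  using tendsto_Re[OF tendsto_ip_self[OF assms]]
  by (simp add: sums_def ip_combination_self)

lemma basis_nonzero: "f n \<noteq> 0"
proof
  assume *: "f n = 0"
  \<comment> \<open>If \<open>f n\<close> were 0, \<open>d\<close> and the zero sequence would be
    two expansions of 0.\<close>
  define d where "d = (\<lambda>i. if i = n then 1 else 0 :: complex)"
  have z: "d i *\<^sub>C f i = 0" for i by (simp add: d_def *)
  have ex1: "\<exists>!c. limitin J_topology (\<lambda>N. \<Sum>n<N. c n *\<^sub>C f n) 0 sequentially"
    using basis by (simp add: schauder_basis_def)
  have "limitin J_topology (\<lambda>N. \<Sum>n<N. d n *\<^sub>C f n) 0 sequentially"
    unfolding z by (simp add: limitin_J_topology)
  moreover have "limitin J_topology (\<lambda>N. \<Sum>n<N. 0 *\<^sub>C f n) 0 sequentially"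
    by (simp add: limitin_J_topology)
  ultimately have "d = (\<lambda>_. 0)"
    using the1_equality[OF ex1, of d] the1_equality[OF ex1, of "\<lambda>_. 0"] by simp
  then have "d n = 0" by simp
  then show False by (simp add: d_def)
qed

text \<open>By the coefficient formula a neutral \<open>f n\<close> would be orthogonal to every
  \<open>x\<close>, in particular to \<open>J (f n)\<close>, which forces its norm to be 0.\<close>

lemma basis_nonneutral: "Re (ip (f n) (f n)) \<noteq> 0"
proof
  assume "Re (ip (f n) (f n)) = 0"
  then have "ip (f n) (f n) = 0" using ip_self_of_real[of "f n"] by simp
  then have "ip x (f n) = 0" for x
    by (metis expansion_ex expansion_coefficient mult_zero_right)
  then have "J_norm (f n) = 0" by (simp add: J_norm_def J_ip_def)
  then show False using basis_nonzero by simp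
qed

section \<open>Closed spans of subfamilies and their maximality\<close>

text \<open>The right-hand side is closed as an intersection of orthogonal complements. Conversely,
  its elements have vanishing coefficients outside \<open>N\<close>, so the partial sums of their
  full expansion already lie in the span.\<close>

lemma closure_of_span_basis:
  "J_topology closure_of span (f ` N) = {x. \<forall>n. n \<notin> N \<longrightarrow> ip x (f n) = 0}" (is "_ = ?S")
proof
  \<comment> \<open>The empty intersection is split off, as closedness of an intersection is stated
    for nonempty families.\<close>
  have "?S = (if N = UNIV then UNIV else \<Inter>n\<in>-N. {x. ip x (f n) = 0})" by auto
  also have "closedin J_topology \<dots>"
    using closedin_topspace[of J_topology]
    by (auto intro!: closedin_INT closedin_orthogonal)
  finally have closed: "closedin J_topology ?S" .
  have "subspace ?S" by (auto simp: subspace_def ip_add_left ip_scale_left)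
  moreover have "f ` N \<subseteq> ?S" by (auto intro: ip_basis)
  ultimately have "span (f ` N) \<subseteq> ?S" by (intro span_minimal)
  then show "J_topology closure_of span (f ` N) \<subseteq> ?S"
    using closed by (rule closure_of_minimal)
  show "?S \<subseteq> J_topology closure_of span (f ` N)"
  proof
    fix x assume x: "x \<in> ?S"
    obtain c where c: "limitin J_topology (\<lambda>N. \<Sum>n<N. c n *\<^sub>C f n) x sequentially"
      by (rule expansion_ex)
    have "c n *\<^sub>C f n \<in> span (f ` N)" for n
    proof (cases "n \<in> N")
      case False
      then have "c n = 0"
        using x expansion_coefficient[OF c, of n] basis_nonneutral[of n] by auto
      then show ?thesis by (simp add: span_zero)
    qed (auto intro: span_scale span_base)
    then have "(\<Sum>n<K. c n *\<^sub>C f n) \<in> span (f ` N)" for K by (auto intro: span_sum)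
    then show "x \<in> J_topology closure_of span (f ` N)"
      using c unfolding J_topology_def J_metric.closure_of_sequentially
      by (auto intro!: exI[of _ "\<lambda>K. \<Sum>n<K. c n *\<^sub>C f n"])
  qed
qed

text \<open>As no \<open>f n\<close> is neutral and \<open>s \<noteq> 0\<close>, every index outside
  \<open>N\<close> carries strictly the opposite sign. The second claim rests on this
  strictness.\<close>

lemma maximal_definite_closure:
  assumes N: "N = {n. 0 < s * Re (ip (f n) (f n))}" and "s \<noteq> 0"
  defines "M \<equiv> J_topology closure_of span (f ` N)"
  shows "definite_subspace s M" and "\<not> (\<exists>L. definite_subspace s L \<and> M \<subset> L)"
proof -
  have M: "M = {x. \<forall>n. n \<notin> N \<longrightarrow> ip x (f n) = 0}"
    by (simp add: M_def closure_of_span_basis)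
  have pos: "0 < s * Re (ip (f n) (f n))" if "n \<in> N" for n using that N by simp
  have neg: "s * Re (ip (f n) (f n)) < 0" if "n \<notin> N" for n
    using that N \<open>s \<noteq> 0\<close> basis_nonneutral[of n] by (simp add: not_less order.order_iff_strict)
  have "subspace M" by (auto simp: M subspace_def ip_add_left ip_scale_left)
  then have closed: "closed_subspace M" by (simp add: closed_subspace_def M_def)
  \<comment> \<open>Only indices in \<open>N\<close> contribute to the expansion of
    \<open>x\<close>, so the form is a convergent sum of nonnegative terms, at least one of them
    positive.\<close>
  have "0 < s * Re (ip x x)" if "x \<in> M" "x \<noteq> 0" for x
  proof -
    obtain c where c: "limitin J_topology (\<lambda>N. \<Sum>n<N. c n *\<^sub>C f n) x sequentially"
      by (rule expansion_ex)
    define t where "t = (\<lambda>n. (cmod (c n))\<^sup>2 * (s * Re (ip (f n) (f n))))"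
    have t: "t sums (s * Re (ip x x))"
      using sums_mult[OF expansion_form[OF c], of s] by (simp add: t_def mult_ac)
    have c0: "c n = 0" if "n \<notin> N" for n
      using that \<open>x \<in> M\<close> expansion_coefficient[OF c, of n] basis_nonneutral[of n] by (auto simp: M)
    then have nonneg: "0 \<le> t n" for n using pos[of n] by (cases "n \<in> N") (auto simp: t_def)
    have "\<exists>n. c n \<noteq> 0"
    proof (rule ccontr)
      assume "\<not> ?thesis"
      then have "(\<lambda>_::nat. J_norm (0 - x)) \<longlonglongrightarrow> 0"
        using c by (simp add: limitin_J_topology)
      then show False using \<open>x \<noteq> 0\<close> by (simp add: LIMSEQ_const_iff)
    qed
    then obtain n where "c n \<noteq> 0" by blast
    then have "0 < t n" using c0[of n] pos[of n] by (cases "n \<in> N") (auto simp: t_def)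
    then have "0 < suminf t"
      using suminf_pos2[of t n] t nonneg by (auto simp: sums_iff)
    then show ?thesis using t by (simp add: sums_iff)
  qed
  then show "definite_subspace s M" using closed by (simp add: definite_subspace_def)
  show "\<not> (\<exists>L. definite_subspace s L \<and> M \<subset> L)"
  proof
    assume "\<exists>L. definite_subspace s L \<and> M \<subset> L"
    then obtain L x where L: "definite_subspace s L" "M \<subseteq> L" and x: "x \<in> L" "x \<notin> M" by blast
    have sub: "subspace L"
      using L(1) by (simp add: definite_subspace_def closed_subspace_def)
    have Lpos: "0 \<le> s * Re (ip y y)" if "y \<in> L" for y
      using L(1) that by (cases "y = 0") (auto simp: definite_subspace_def less_imp_le)
    obtain c where c: "limitin J_topology (\<lambda>N. \<Sum>n<N. c n *\<^sub>C f n) x sequentially"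
      by (rule expansion_ex)
    define t where "t = (\<lambda>n. (cmod (c n))\<^sup>2 * (s * Re (ip (f n) (f n))))"
    have t: "t sums (s * Re (ip x x))"
      using sums_mult[OF expansion_form[OF c], of s] by (simp add: t_def mult_ac)
    have fL: "f n \<in> L" if "n \<in> N" for n
      using that L(2) by (auto simp: M intro: ip_basis)
    \<comment> \<open>The finite part \<open>y\<close> of the expansion over \<open>F\<close> lies
      in \<open>L\<close>, and \<open>x - y\<close> is orthogonal to \<open>y\<close>.
      Semidefiniteness of the form at \<open>x - y\<close>, again in \<open>L\<close>, is the
      claimed inequality.\<close>
    have bessel: "sum t F \<le> s * Re (ip x x)" if F: "finite F" "F \<subseteq> N" for F
    proof -
      define y where "y = (\<Sum>i\<in>F. c i *\<^sub>C f i)"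
      have "y \<in> L" unfolding y_def using fL F(2) sub
        by (auto intro!: subspace_sum subspace_scale)
      then have "x - y \<in> L" using x sub by (auto intro: subspace_diff)
      have yy: "ip y y = of_real (\<Sum>i\<in>F. (cmod (c i))\<^sup>2 * Re (ip (f i) (f i)))"
        unfolding y_def by (rule ip_combination_self[OF F(1)])
      have "ip y x = (\<Sum>i\<in>F. c i * cnj (ip x (f i)))"
        unfolding y_def by (rule ip_combination_left)
      also have "\<dots> = (\<Sum>i\<in>F. c i * cnj (ip y (f i)))"
        unfolding y_def using F(1) expansion_coefficient[OF c]
        by (intro sum.cong refl) (simp add: ip_combination_basis)
      also have "\<dots> = ip y y"
        unfolding y_def by (rule ip_combination_left[symmetric])
      finally have "ip y x = ip y y" .
      moreover have "ip x y = ip y y"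
        using \<open>ip y x = ip y y\<close> by (metis ip_commute)
      ultimately have "ip (x - y) (x - y) = ip x x - ip y y"
        by (simp add: ip_diff_left ip_diff_right)
      then have "s * Re (ip y y) \<le> s * Re (ip x x)"
        using Lpos[OF \<open>x - y \<in> L\<close>] by (simp add: right_diff_distrib)
      then show ?thesis by (simp add: yy t_def sum_distrib_left mult_ac)
    qed
    have t_nonpos: "t n \<le> 0" if "n \<notin> N" for n
      unfolding t_def by (rule mult_nonneg_nonpos[OF zero_le_power2 less_imp_le[OF neg[OF that]]])
    have "c n = 0" if n: "n \<notin> N" for n
    proof -
      \<comment> \<open>Bessel bounds the part over \<open>N\<close>; from the nonpositive rest only
        the term at \<open>n\<close> is kept. Letting \<open>K\<close> tend to infinity gives
        \<open>0 \<le> t n\<close>, whereas \<open>c n \<noteq> 0\<close> would make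
        \<open>t n\<close> negative.\<close>
      have "sum t {..<K} \<le> s * Re (ip x x) + t n" if "n < K" for K
      proof -
        have "sum t {..<K} = sum t ({..<K} \<inter> N) + sum t ({..<K} - N)"
          by (rule sum.Int_Diff) simp
        also have "sum t ({..<K} - N) \<le> sum t {n}"
        proof -
          have "sum t ({..<K} - N) = t n + sum t ({..<K} - N - {n})"
            using n that by (intro sum.remove) auto
          moreover have "sum t ({..<K} - N - {n}) \<le> 0"
            by (intro sum_nonpos t_nonpos) auto
          ultimately show ?thesis by simp
        qed
        finally show ?thesis using bessel[of "{..<K} \<inter> N"] by simp
      qed
      then have "s * Re (ip x x) \<le> s * Re (ip x x) + t n"
        using t unfolding sums_def
        by (intro LIMSEQ_le_const2[of "\<lambda>K. sum t {..<K}"])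
          (auto simp: Suc_le_eq intro!: exI[of _ "Suc n"])
      then have "0 \<le> t n" by simp
      show ?thesis
      proof (rule ccontr)
        assume "c n \<noteq> 0"
        then have "t n < 0"
          unfolding t_def by (intro mult_pos_neg neg[OF n]) simp
        then show False using \<open>0 \<le> t n\<close> by simp
      qed
    qed
    then have "x \<in> M" using expansion_coefficient[OF c] by (simp add: M)
    then show False using x by simp
  qed
qed

text \<open>The weak inequality defining \<open>N_plus\<close> becomes strict because the basis has
  no neutral vectors.\<close>

lemma N_plus_iff: "N_plus f = {n. 0 < 1 * Re (ip (f n) (f n))}"
  using basis_nonneutral by (auto simp: N_plus_def order.order_iff_strict)

lemma N_minus_iff: "N_minus f = {n. 0 < (- 1) * Re (ip (f n) (f n))}"
  by (auto simp: N_minus_def)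

lemma maximal_positive_M_plus: "maximal_positive (M_plus f)"
  using maximal_definite_closure[OF N_plus_iff] by (simp add: maximal_positive_iff M_plus_def)

lemma maximal_negative_M_minus: "maximal_negative (M_minus f)"
  using maximal_definite_closure[OF N_minus_iff] by (simp add: maximal_negative_iff M_minus_def)

section \<open>Frame inequalities and J-boundedness\<close>

text \<open>The constant sign on \<open>N\<close> prevents cancellation, so
  \<open>cmod (ip x x)\<close> is the sum of \<open>(cmod (c i))\<^sup>2 * g i\<close>. The frame
  inequalities then follow termwise from
  \<open>A * g i \<le> (g i)\<^sup>2 \<le> B * g i\<close>.\<close>

lemma frame_bounds_if_bounded:
  assumes A: "\<And>n. A \<le> cmod (ip (f n) (f n))" and B: "\<And>n. cmod (ip (f n) (f n)) \<le> B"
    and definite: "s \<in> {1, - 1}" "\<And>n. n \<in> N \<Longrightarrow> 0 \<le> s * Re (ip (f n) (f n))"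
  shows "frame_bounds f N A B"
  unfolding frame_bounds_def
proof
  fix x assume "x \<in> span (f ` N)"
  then obtain T where T: "finite T" "T \<subseteq> f ` N" "x \<in> span T"
    unfolding span_explicit by (auto intro: span_sum span_scale span_base)
  \<comment> \<open>Lifting \<open>T\<close> to indices on which \<open>f\<close> is injective turns
    a sum over vectors into a sum over indices.\<close>
  then obtain F where F: "F \<subseteq> N" "inj_on f F" "T = f ` F" "finite F"
    unfolding subset_image_inj by (metis finite_image_iff)
  obtain u where "x = (\<Sum>v\<in>T. u v *\<^sub>C v)"
    using T span_finite by blast
  then obtain c where x: "x = (\<Sum>i\<in>F. c i *\<^sub>C f i)"
    using F that[of "u \<circ> f"] by (simp add: sum.reindex)
  define g where "g i = cmod (ip (f i) (f i))" for i
  have g: "g i = s * Re (ip (f i) (f i))" if "i \<in> N" for i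
    using definite(1) definite(2)[OF that] by (auto simp: g_def cmod_ip_self)
  have coeff: "(cmod (ip x (f n)))\<^sup>2 = (if n \<in> F then (cmod (c n))\<^sup>2 * (g n)\<^sup>2 else 0)" for n
    using F(4) by (simp add: x ip_combination_basis g_def norm_mult power_mult_distrib)
  have "(\<Sum>i\<in>F. (cmod (c i))\<^sup>2 * g i) = s * (\<Sum>i\<in>F. (cmod (c i))\<^sup>2 * Re (ip (f i) (f i)))"
    using g F(1) by (auto simp: sum_distrib_left mult_ac intro!: sum.cong)
  also have "\<bar>\<dots>\<bar> = \<bar>\<Sum>i\<in>F. (cmod (c i))\<^sup>2 * Re (ip (f i) (f i))\<bar>"
    using definite(1) by (auto simp: abs_mult)
  also have "\<dots> = cmod (ip x x)"
    unfolding x ip_combination_self[OF F(4)] norm_of_real ..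
  finally have form: "cmod (ip x x) = (\<Sum>i\<in>F. (cmod (c i))\<^sup>2 * g i)"
    by (simp add: g_def sum_nonneg)
  \<comment> \<open>The products \<open>ip x (f n)\<close> vanish off the finite set
    \<open>F\<close>, which gives both summability and the value of the sum.\<close>
  have hs: "((\<lambda>n. (cmod (ip x (f n)))\<^sup>2) has_sum (\<Sum>n\<in>F. (cmod (c n))\<^sup>2 * (g n)\<^sup>2)) N"
  proof (rule has_sum_cong_neutral[THEN iffD1])
    show "((\<lambda>n. (cmod (c n))\<^sup>2 * (g n)\<^sup>2) has_sum (\<Sum>n\<in>F. (cmod (c n))\<^sup>2 * (g n)\<^sup>2)) F"
      using F(4) by (rule has_sum_finite)
  qed (use F(1) in \<open>auto simp: coeff\<close>)
  have "A * (\<Sum>i\<in>F. (cmod (c i))\<^sup>2 * g i) \<le> (\<Sum>n\<in>F. (cmod (c n))\<^sup>2 * (g n)\<^sup>2)"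
    unfolding sum_distrib_left
  proof (rule sum_mono)
    fix i
    show "A * ((cmod (c i))\<^sup>2 * g i) \<le> (cmod (c i))\<^sup>2 * (g i)\<^sup>2"
      using mult_right_mono[OF A[of i], of "(cmod (c i))\<^sup>2 * g i"]
      by (simp add: g_def power2_eq_square mult_ac)
  qed
  moreover have "(\<Sum>n\<in>F. (cmod (c n))\<^sup>2 * (g n)\<^sup>2) \<le> B * (\<Sum>i\<in>F. (cmod (c i))\<^sup>2 * g i)"
    unfolding sum_distrib_left
  proof (rule sum_mono)
    fix i
    show "(cmod (c i))\<^sup>2 * (g i)\<^sup>2 \<le> B * ((cmod (c i))\<^sup>2 * g i)"
      using mult_right_mono[OF B[of i], of "(cmod (c i))\<^sup>2 * g i"]
      by (simp add: g_def power2_eq_square mult_ac)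
  qed
  ultimately show "(\<lambda>n. (cmod (ip x (f n)))\<^sup>2) summable_on N \<and>
        A * cmod (ip x x) \<le> (\<Sum>\<^sub>\<infinity>n\<in>N. (cmod (ip x (f n)))\<^sup>2) \<and>
        (\<Sum>\<^sub>\<infinity>n\<in>N. (cmod (ip x (f n)))\<^sup>2) \<le> B * cmod (ip x x)"
    using hs by (simp add: form infsumI has_sum_imp_summable)
qed

text \<open>The inequalities are tested at \<open>x = f n\<close>: orthogonality reduces the frame
  sum to \<open>g\<^sup>2\<close>, and dividing by \<open>g > 0\<close> leaves the bounds.\<close>

lemma bounded_if_frame_bounds:
  assumes "frame_bounds f N A B" "n \<in> N"
  shows "A \<le> cmod (ip (f n) (f n)) \<and> cmod (ip (f n) (f n)) \<le> B"
proof -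
  define g where "g = cmod (ip (f n) (f n))"
  have "0 < g" using basis_nonneutral[of n] by (simp add: g_def cmod_ip_self)
  have "(\<Sum>\<^sub>\<infinity>m\<in>N. (cmod (ip (f n) (f m)))\<^sup>2) = (\<Sum>\<^sub>\<infinity>m\<in>{n}. (cmod (ip (f n) (f m)))\<^sup>2)"
    using assms(2) by (intro infsum_cong_neutral) (auto simp: ip_basis)
  also have "\<dots> = g\<^sup>2" by (simp add: g_def)
  finally have "A * g \<le> g\<^sup>2" "g\<^sup>2 \<le> B * g"
    using assms span_base[of "f n" "f ` N"] unfolding frame_bounds_def g_def by auto
  then show ?thesis using \<open>0 < g\<close> by (simp add: power2_eq_square flip: g_def)
qed

theorem J_frame_iff_J_bounded: "J_frame f \<longleftrightarrow> J_bounded f"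
proof
  assume "J_frame f"
  then obtain A B where "0 < A" "frame_bounds f (N_plus f) A B" "frame_bounds f (N_minus f) A B"
    unfolding J_frame_def by blast
  moreover have "n \<in> N_plus f \<or> n \<in> N_minus f" for n
    by (auto simp: N_plus_def N_minus_def)
  ultimately show "J_bounded f"
    unfolding J_bounded_def using bounded_if_frame_bounds by meson
next
  assume "J_bounded f"
  then obtain A B where AB: "0 < A" "\<And>n. A \<le> cmod (ip (f n) (f n))"
    "\<And>n. cmod (ip (f n) (f n)) \<le> B"
    unfolding J_bounded_def by blast
  have "frame_bounds f (N_plus f) A B"
    using AB(2,3) by (rule frame_bounds_if_bounded[where s = 1]) (auto simp: N_plus_def)
  moreover have "frame_bounds f (N_minus f) A B"
    using AB(2,3) by (rule frame_bounds_if_bounded[where s = "- 1"]) (auto simp: N_minus_def)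
  \<comment> \<open>\<open>J_bounded\<close> does not state this order of the constants; any single
    index yields it.\<close>
  moreover have "A \<le> B" using AB(2)[of 0] AB(3)[of 0] by simp
  ultimately show "J_frame f"
    unfolding J_frame_def
    using AB(1) maximal_positive_M_plus maximal_negative_M_minus by blast
qed

end

theorem corollary4p6:
  fixes cscale :: "complex \<Rightarrow> 'a::ab_group_add \<Rightarrow> 'a"
    and ip :: "'a \<Rightarrow> 'a \<Rightarrow> complex"
    and Hp Hm :: "'a set"
    and J :: "'a \<Rightarrow> 'a"
    and f :: "nat \<Rightarrow> 'a"
  assumes "krein_space cscale ip Hp Hm J"
    and "krein_space.schauder_basis cscale ip J f"
    and "krein_space.J_orthogonal ip f"
  shows "krein_space.J_frame cscale ip J f \<longleftrightarrow> krein_space.J_bounded ip f"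
proof -
  interpret krein_space cscale ip Hp Hm J by fact
  interpret J_orthogonal_basis cscale ip Hp Hm J f
    by standard (fact assms)+
  show ?thesis by (rule J_frame_iff_J_bounded)
qed

end
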